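(* (Dual Orlicz isoperimetric inequality) Let $K\in\mathcal{S}_0$ be a star body about the origin in $\mathbb{R}^n$ and let $\phi:(0,\infty)\to(0,\infty)$ be continuous. If $F(t)=\phi(t^{1/n})$ is concave, then $$\widetilde{S}_\phi(K)\leq\widetilde{S}_\phi(B_K),$$ while if $F$ is convex, the inequality is reversed. If $F$ is strictly concave (or strictly convex, as appropriate), equality holds if and only if $K$ is an origin-symmetric Euclidean ball.
   Context: $B_2^n$ is the closed unit Euclidean ball of $\mathbb{R}^n$, $S^{n-1}$ the unit sphere, $\sigma$ the spherical measure, $|\cdot|$ volume. A compact set $K$ that contains the closed segment from the origin to each of its points has radial function $\rho_K(u)=\max\{\lambda:\lambda u\in K\}$, $u\in S^{n-1}$; $K$ is a star body about the origin ($K\in\mathcal{S}_0$) if $\rho_K$ is continuous and positive on $S^{n-1}$. $\mathrm{vrad}(K)=(|K|/|B_2^n|)^{1/n}$ and $B_K=\mathrm{vrad}(K)B_2^n$. For $K,L\in\mathcal{S}_0$ the Orlicz $L_\phi$-dual mixed volume is $$\widetilde{V}_\phi(K,L)=\frac1n\int_{S^{n-1}}\phi\!\left(\frac{\rho_L(u)}{\rho_K(u)}\right)\rho_K(u)^n\,d\sigma(u),$$ and the Orlicz $L_\phi$-dual surface area is $\widetilde{S}_\phi(K)=n\widetilde{V}_\phi(K,B_2^n)$. An origin-symmetric Euclidean ball is $rB_2^n$ with $r>0$. *)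

theory Defs
  imports "HOL-Analysis.Analysis"
begin

text \<open>
  Throughout, an arbitrary Euclidean space of dimension \<open>n = DIM('a)\<close> plays the role of
  \<open>\<real>\<^sup>n\<close>, \<open>cball 0 1\<close> is \<open>B\<^sub>2\<^sup>n\<close> and \<open>sphere 0 1\<close> is the unit sphere.
\<close>

text \<open>
  The (unnormalised) spherical Lebesgue measure: the measure of a Borel subset \<open>A\<close> of the unit
  sphere is \<open>n\<close> times the volume of the cone over \<open>A\<close> with apex at the origin, see
  \<open>emeasure_spherical_measure\<close> below. Recall \<open>sgn x = x /\<^sub>R norm x\<close>.
\<close>
definition spherical_measure :: "'a::euclidean_space measure" where
  "spherical_measure =
     distr (scale_measure (of_nat DIM('a)) (restrict_space lborel (cball 0 1 - {0})))
           (restrict_space borel (sphere 0 1)) sgn"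

lemma space_spherical_measure: "space spherical_measure = sphere 0 1"
  by (simp add: spherical_measure_def space_restrict_space)

lemma sets_spherical_measure:
  "sets spherical_measure = sets (restrict_space borel (sphere 0 1))"
  by (simp add: spherical_measure_def)

lemma emeasure_spherical_measure:
  fixes A :: "'a::euclidean_space set"
  assumes "A \<in> sets borel" "A \<subseteq> sphere 0 1"
  shows "emeasure spherical_measure A =
           of_nat DIM('a) * emeasure lborel {r *\<^sub>R u | r u. 0 < r \<and> r \<le> 1 \<and> u \<in> A}"
proof -
  let ?D = "cball 0 1 - {0::'a}"
  let ?M = "scale_measure (of_nat DIM('a)) (restrict_space lborel ?D)"
  have sgn_measurable: "sgn \<in> measurable ?M (restrict_space borel (sphere (0::'a) 1))"
  proof (rule measurable_restrict_space2)
    show "sgn \<in> space ?M \<rightarrow> sphere (0::'a) 1"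
      by (auto simp: space_scale_measure space_restrict_space norm_sgn)
    have "sgn \<in> borel_measurable (borel :: 'a measure)"
      unfolding sgn_div_norm by measurable
    then have "sgn \<in> borel_measurable (restrict_space lborel ?D)"
      by (intro measurable_restrict_space1) simp
    then show "sgn \<in> borel_measurable ?M"
      by (simp cong: measurable_cong_sets)
  qed
  have cone: "sgn -` A \<inter> ?D = {r *\<^sub>R u | r u. 0 < r \<and> r \<le> 1 \<and> u \<in> A}" (is "?L = ?R")
  proof
    show "?L \<subseteq> ?R"
    proof
      fix x assume x: "x \<in> ?L"
      then have "x = norm x *\<^sub>R sgn x" by (simp add: sgn_div_norm)
      with x show "x \<in> ?R"
        by (smt (verit) DiffD1 DiffD2 IntD1 IntD2 insertI1 mem_Collect_eq mem_cball_0 vimageE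
              zero_less_norm_iff)
    qed
    show "?R \<subseteq> ?L"
    proof
      fix x assume "x \<in> ?R"
      then obtain r u where ru: "x = r *\<^sub>R u" "0 < r" "r \<le> 1" "u \<in> A" by blast
      with assms have "norm u = 1" by auto
      then have "sgn x = u" using ru by (simp add: sgn_div_norm)
      with ru \<open>norm u = 1\<close> show "x \<in> ?L" by auto
    qed
  qed
  have "A \<in> sets (restrict_space borel (sphere 0 1))"
    using assms by (auto simp: sets_restrict_space_iff)
  then have "emeasure spherical_measure A =
      of_nat DIM('a) * emeasure (restrict_space lborel ?D) (sgn -` A \<inter> ?D)"
    unfolding spherical_measure_def
    by (subst emeasure_distr[OF sgn_measurable])
       (simp_all add: space_scale_measure space_restrict_space)
  also have "emeasure (restrict_space lborel ?D) (sgn -` A \<inter> ?D) =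
      emeasure lborel (sgn -` A \<inter> ?D)"
    by (rule emeasure_restrict_space) auto
  finally show ?thesis
    by (simp only: cone)
qed

definition radial :: "'a::euclidean_space set \<Rightarrow> 'a \<Rightarrow> real" where
  "radial K u = (GREATEST l. l *\<^sub>R u \<in> K)"

text \<open>
  Non-emptiness has to be required for the maximum in \<open>radial\<close> to exist; together with the
  segment condition it gives \<open>0 \<in> K\<close>.
\<close>
definition star_body :: "'a::euclidean_space set \<Rightarrow> bool" where
  "star_body K \<longleftrightarrow>
     compact K \<and> K \<noteq> {} \<and> (\<forall>x\<in>K. closed_segment 0 x \<subseteq> K) \<and>
     continuous_on (sphere 0 1) (radial K) \<and> (\<forall>u\<in>sphere 0 1. 0 < radial K u)"

definition vrad :: "'a::euclidean_space set \<Rightarrow> real" where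
  "vrad K = root DIM('a) (measure lborel K / measure lborel (cball (0::'a) 1))"

definition vrad_ball :: "'a::euclidean_space set \<Rightarrow> 'a set" where
  "vrad_ball K = (\<lambda>x. vrad K *\<^sub>R x) ` cball 0 1"

definition orlicz_dual_mixed_volume ::
    "(real \<Rightarrow> real) \<Rightarrow> 'a::euclidean_space set \<Rightarrow> 'a set \<Rightarrow> real" where
  "orlicz_dual_mixed_volume \<phi> K L =
     1 / real DIM('a) *
     (LINT u|spherical_measure. \<phi> (radial L u / radial K u) * radial K u ^ DIM('a))"

definition orlicz_dual_surface_area ::
    "(real \<Rightarrow> real) \<Rightarrow> 'a::euclidean_space set \<Rightarrow> real" where
  "orlicz_dual_surface_area \<phi> K =
     real DIM('a) * orlicz_dual_mixed_volume \<phi> K (cball 0 1)"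

definition origin_symmetric_ball :: "'a::euclidean_space set \<Rightarrow> bool" where
  "origin_symmetric_ball K \<longleftrightarrow> (\<exists>r>0. K = (\<lambda>x. r *\<^sub>R x) ` cball 0 1)"

definition strictly_convex_on :: "'a::real_vector set \<Rightarrow> ('a \<Rightarrow> real) \<Rightarrow> bool" where
  "strictly_convex_on S f \<longleftrightarrow> convex S \<and>
     (\<forall>x\<in>S. \<forall>y\<in>S. \<forall>u>0. \<forall>v>0. x \<noteq> y \<longrightarrow> u + v = 1 \<longrightarrow>
        f (u *\<^sub>R x + v *\<^sub>R y) < u * f x + v * f y)"

definition strictly_concave_on :: "'a::real_vector set \<Rightarrow> ('a \<Rightarrow> real) \<Rightarrow> bool" where
  "strictly_concave_on S f \<longleftrightarrow> strictly_convex_on S (\<lambda>x. - f x)"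

end

theory Submission
  imports Defs
begin

text \<open>
  Write \<open>n\<close> for the dimension, \<open>\<rho>\<close> for the radial function of \<open>K\<close>, \<open>V\<close> for its volume and \<open>\<omega>\<close>
  for the volume of the unit ball. Then the dual surface area of \<open>K\<close> is the integral of
  \<open>F (\<rho>\<^bsup>-n\<^esup>) \<rho>\<^sup>n\<close> over the sphere. By the polar volume formula \<open>\<rho>\<^sup>n d\<sigma>\<close> has total mass \<open>n V\<close>,
  and \<open>\<rho>\<^bsup>-n\<^esup>\<close> has mean \<open>\<omega> / V\<close> with respect to it, so Jensen's inequality compares the area with
  \<open>n V F (\<omega> / V)\<close>, which is the dual surface area of the volume ball. In the strict case equality
  forces \<open>\<rho>\<close> to be constant almost everywhere, hence everywhere by continuity.
\<close>

section \<open>Polar volume formula for functions constant on rays\<close>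

text \<open>Dilation by \<open>c\<close> multiplies Lebesgue measure by the \<open>n\<close>-th
  power of \<open>c\<close>, and since it preserves the cone \<open>A\<close>, it carries the part
  in the unit ball onto the part in the ball of radius \<open>c\<close>.\<close>

lemma emeasure_cone_Int_cball:
  fixes A :: "'a::euclidean_space set"
  assumes [measurable]: "A \<in> sets borel" and "0 < c"
    and cone: "\<And>t x. 0 < t \<Longrightarrow> t *\<^sub>R x \<in> A \<longleftrightarrow> x \<in> A"
  shows "emeasure lborel (A \<inter> cball 0 c) = ennreal (c ^ DIM('a)) * emeasure lborel (A \<inter> cball 0 1)"
proof -
  have B: "A \<inter> cball 0 c \<in> sets borel" by simp
  have "emeasure lborel (A \<inter> cball 0 c) =
     emeasure (density (distr lborel borel (\<lambda>x. 0 + c *\<^sub>R x)) (\<lambda>_. \<bar>c\<bar> ^ DIM('a))) (A \<inter> cball 0 c)"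
    using \<open>0 < c\<close> lborel_affine[of c "0::'a"] by simp
  also have "\<dots> = ennreal (c ^ DIM('a)) * emeasure (distr lborel borel (\<lambda>x. 0 + c *\<^sub>R x)) (A \<inter> cball 0 c)"
    using \<open>0 < c\<close> by (subst emeasure_density_const) (auto simp: ennreal_power)
  also have "emeasure (distr lborel borel (\<lambda>x. 0 + c *\<^sub>R x)) (A \<inter> cball 0 c) =
      emeasure lborel ((\<lambda>x. c *\<^sub>R x) -` (A \<inter> cball 0 c))"
    by (subst emeasure_distr[OF _ B]) simp_all
  also have "(\<lambda>x. c *\<^sub>R x) -` (A \<inter> cball 0 c) = A \<inter> cball 0 1"
    using \<open>0 < c\<close> cone[of c] by auto
  finally show ?thesis .
qed

text \<open>Each level set of \<open>g\<close> is a cone, and over the level set of value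
  \<open>c\<close> the region is this cone cut by the ball of radius \<open>c\<close>. Rescaling
  every piece to the unit ball and summing over the finitely many values gives the formula.\<close>

lemma nn_integral_radial_graph_finite:
  fixes g :: "'a::euclidean_space \<Rightarrow> real"
  assumes [measurable]: "g \<in> borel_measurable borel"
    and hom: "\<And>t x. 0 < t \<Longrightarrow> g (t *\<^sub>R x) = g x"
    and "finite C" and pos: "\<And>c. c \<in> C \<Longrightarrow> 0 < c" and range: "\<And>x. g x \<in> C"
  shows "(\<integral>\<^sup>+x. indicator {x. norm x \<le> g x} x \<partial>lborel) =
    (\<integral>\<^sup>+x. ennreal (g x ^ DIM('a)) * indicator (cball 0 1) x \<partial>lborel)"
proof -
  let ?A = "\<lambda>c. {x. g x = c}"
  have [measurable]: "?A c \<in> sets borel" "cball (0::'a) c \<in> sets borel" for c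
    by simp_all
  have "(\<integral>\<^sup>+x. indicator {x. norm x \<le> g x} x \<partial>lborel) =
      (\<integral>\<^sup>+x. (\<Sum>c\<in>C. indicator (?A c \<inter> cball 0 c) x) \<partial>lborel)"
  proof (intro nn_integral_cong)
    fix x :: 'a
    have "(\<Sum>c\<in>C. indicator (?A c \<inter> cball 0 c) x) =
       (\<Sum>c\<in>C. if c = g x then indicator {x. norm x \<le> g x} x else (0::ennreal))"
      by (intro sum.cong) (auto simp: indicator_def)
    then show "indicator {x. norm x \<le> g x} x = (\<Sum>c\<in>C. indicator (?A c \<inter> cball 0 c) x :: ennreal)"
      using range[of x] \<open>finite C\<close> by simp
  qed
  also have "\<dots> = (\<Sum>c\<in>C. emeasure lborel (?A c \<inter> cball 0 c))"
    by (subst nn_integral_sum) simp_all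
  also have "\<dots> = (\<Sum>c\<in>C. ennreal (c ^ DIM('a)) * emeasure lborel (?A c \<inter> cball 0 1))"
    using pos hom by (intro sum.cong emeasure_cone_Int_cball) auto
  also have "\<dots> = (\<integral>\<^sup>+x. (\<Sum>c\<in>C. ennreal (c ^ DIM('a)) * indicator (?A c \<inter> cball 0 1) x) \<partial>lborel)"
    by (subst nn_integral_sum) (auto simp: nn_integral_cmult_indicator)
  also have "\<dots> = (\<integral>\<^sup>+x. ennreal (g x ^ DIM('a)) * indicator (cball 0 1) x \<partial>lborel)"
  proof (intro nn_integral_cong)
    fix x :: 'a
    have "(\<Sum>c\<in>C. ennreal (c ^ DIM('a)) * indicator (?A c \<inter> cball 0 1) x) =
       (\<Sum>c\<in>C. if c = g x then ennreal (g x ^ DIM('a)) * indicator (cball 0 1) x else 0)"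
      by (intro sum.cong) (auto simp: indicator_def)
    then show "(\<Sum>c\<in>C. ennreal (c ^ DIM('a)) * indicator (?A c \<inter> cball 0 1) x) =
        ennreal (g x ^ DIM('a)) * indicator (cball 0 1) x"
      using range[of x] \<open>finite C\<close> by simp
  qed
  finally show ?thesis .
qed

text \<open>
  The volume formula in polar coordinates, phrased for a function that is constant on rays; the
  general case follows by rounding up to multiples of \<open>1 / Suc k\<close>, so that the sets converge to the
  closed region without a boundary term.
\<close>
lemma emeasure_radial_graph:
  fixes g :: "'a::euclidean_space \<Rightarrow> real"
  assumes g[measurable]: "g \<in> borel_measurable borel"
    and hom: "\<And>t x. 0 < t \<Longrightarrow> g (t *\<^sub>R x) = g x"
    and pos: "\<And>x. 0 < g x" and bound: "\<And>x. g x \<le> M"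
  shows "emeasure lborel {x. norm x \<le> g x} =
    (\<integral>\<^sup>+x. ennreal (g x ^ DIM('a)) * indicator (cball 0 1) x \<partial>lborel)"
proof -
  define h where "h k x = real_of_int \<lceil>real (Suc k) * g x\<rceil> / real (Suc k)" for k x
  have [measurable]: "cball (0::'a) c \<in> sets borel" for c
    by simp
  have h_meas[measurable]: "h k \<in> borel_measurable borel" for k
    unfolding h_def by measurable
  have h_ge: "g x \<le> h k x" for k x
  proof -
    have "g x = real (Suc k) * g x / real (Suc k)" by simp
    also have "\<dots> \<le> h k x"
      unfolding h_def by (intro divide_right_mono) (auto simp del: of_nat_Suc)
    finally show ?thesis .
  qed
  have h_le: "h k x \<le> g x + 1 / real (Suc k)" for k x
  proof -
    have "h k x \<le> (real (Suc k) * g x + 1) / real (Suc k)"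
      unfolding h_def by (intro divide_right_mono of_int_ceiling_le_add_one) simp
    also have "\<dots> = g x + 1 / real (Suc k)"
      by (simp add: add_divide_distrib del: of_nat_Suc)
    finally show ?thesis .
  qed
  \<comment> \<open>This bound is independent of \<open>k\<close> and yields the integrable
    majorants for both dominated convergence arguments.\<close>
  have h_bound: "h k x \<le> M + 1" for k x
  proof -
    have "1 / real (Suc k) \<le> 1" by simp
    then show ?thesis using h_le[of k x] bound[of x] by linarith
  qed
  have h_pos: "0 < h k x" for k x
    using h_ge[of x k] pos[of x] by linarith
  have h_lim: "(\<lambda>k. h k x) \<longlonglongrightarrow> g x" for x
  proof (rule tendsto_sandwich[OF _ _ tendsto_const])
    have "(\<lambda>k. g x + 1 / real (Suc k)) \<longlonglongrightarrow> g x + 0"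
      by (intro tendsto_add tendsto_const LIMSEQ_Suc[OF lim_1_over_n])
    then show "(\<lambda>k. g x + 1 / real (Suc k)) \<longlonglongrightarrow> g x" by simp
  qed (use h_ge h_le in auto)
  have eq: "(\<integral>\<^sup>+x. indicator {x. norm x \<le> h k x} x \<partial>lborel) =
      (\<integral>\<^sup>+x. ennreal (h k x ^ DIM('a)) * indicator (cball 0 1) x \<partial>lborel)" for k
  proof (rule nn_integral_radial_graph_finite[OF h_meas])
    \<comment> \<open>The index starts at 1 because \<open>g\<close> is positive, which keeps every
      value positive; the upper end comes from the bound \<open>M\<close> and makes the set
      finite.\<close>
    let ?C = "(\<lambda>i. real_of_int i / real (Suc k)) ` {1..\<lceil>real (Suc k) * M\<rceil>}"
    show "finite ?C" by simp
    show "h k (t *\<^sub>R x) = h k x" if "0 < t" for t x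
      using hom[OF that, of x] by (simp add: h_def)
    show "0 < c" if "c \<in> ?C" for c
      using that by (auto intro!: divide_pos_pos simp del: of_nat_Suc)
    show "h k x \<in> ?C" for x
    proof -
      have "0 < real (Suc k) * g x" using pos by simp
      then have "1 \<le> \<lceil>real (Suc k) * g x\<rceil>" by linarith
      moreover have "\<lceil>real (Suc k) * g x\<rceil> \<le> \<lceil>real (Suc k) * M\<rceil>"
        using bound by (intro ceiling_mono mult_left_mono) auto
      ultimately show ?thesis unfolding h_def by (intro imageI) simp
    qed
  qed
  have lim_L: "(\<lambda>k. \<integral>\<^sup>+x. indicator {x. norm x \<le> h k x} x \<partial>lborel) \<longlonglongrightarrow>
      (\<integral>\<^sup>+x. indicator {x. norm x \<le> g x} x \<partial>lborel)"
  proof (rule nn_integral_dominated_convergence[where w = "indicator (cball 0 (M + 1))"])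
    show "AE x in lborel. indicator {x. norm x \<le> h k x} x \<le> (indicator (cball 0 (M + 1)) x :: ennreal)" for k
      using h_bound[of k] by (intro AE_I2) (force simp: indicator_def intro: order_trans)
    show "(\<integral>\<^sup>+x. indicator (cball (0::'a) (M + 1)) x \<partial>lborel) < \<infinity>"
      using emeasure_lborel_cball_finite by simp
    show "AE x in lborel. (\<lambda>k. indicator {x. norm x \<le> h k x} x :: ennreal) \<longlonglongrightarrow> indicator {x. norm x \<le> g x} x"
    proof (intro AE_I2 tendsto_eventually)
      fix x :: 'a
      \<comment> \<open>Inside the closed region the indicators are 1 for all \<open>k\<close>, as
        \<open>g \<le> h k\<close>; outside it \<open>h k x\<close> eventually drops below
        \<open>norm x\<close>.\<close>
      show "\<forall>\<^sub>F k in sequentially. indicator {x. norm x \<le> h k x} x = (indicator {x. norm x \<le> g x} x :: ennreal)"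
      proof (cases "norm x \<le> g x")
        case True
        then show ?thesis using order_trans[OF True h_ge] by simp
      next
        case False
        then have "\<forall>\<^sub>F k in sequentially. h k x < norm x"
          using order_tendstoD(2)[OF h_lim] by auto
        then show ?thesis by eventually_elim (use False in auto)
      qed
    qed
  qed simp_all
  have lim_R: "(\<lambda>k. \<integral>\<^sup>+x. ennreal (h k x ^ DIM('a)) * indicator (cball 0 1) x \<partial>lborel) \<longlonglongrightarrow>
      (\<integral>\<^sup>+x. ennreal (g x ^ DIM('a)) * indicator (cball 0 1) x \<partial>lborel)"
  proof (rule nn_integral_dominated_convergence[where w = "\<lambda>x. ennreal ((M + 1) ^ DIM('a)) * indicator (cball 0 1) x"])
    show "AE x in lborel. ennreal (h k x ^ DIM('a)) * indicator (cball 0 1) x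
        \<le> ennreal ((M + 1) ^ DIM('a)) * indicator (cball 0 1) x" for k
      using h_bound[of k] h_pos[of k]
      by (intro AE_I2 mult_right_mono ennreal_leI power_mono) (auto intro: less_imp_le)
    show "(\<integral>\<^sup>+x. ennreal ((M + 1) ^ DIM('a)) * indicator (cball (0::'a) 1) x \<partial>lborel) < \<infinity>"
      using emeasure_lborel_cball_finite[of "0::'a" 1]
      by (simp add: nn_integral_cmult_indicator ennreal_mult_less_top)
    show "AE x in lborel. (\<lambda>k. ennreal (h k x ^ DIM('a)) * indicator (cball 0 1) x) \<longlonglongrightarrow>
        ennreal (g x ^ DIM('a)) * indicator (cball 0 1) x"
    proof (intro AE_I2)
      fix x :: 'a
      have "(\<lambda>k. ennreal (h k x ^ DIM('a))) \<longlonglongrightarrow> ennreal (g x ^ DIM('a))"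
        by (intro tendsto_ennrealI tendsto_power h_lim)
      then show "(\<lambda>k. ennreal (h k x ^ DIM('a)) * indicator (cball 0 1) x) \<longlonglongrightarrow>
        ennreal (g x ^ DIM('a)) * indicator (cball 0 1) x"
        by (cases "x \<in> cball 0 1") simp_all
    qed
  qed simp_all
  show ?thesis
    using LIMSEQ_unique[OF lim_L] lim_R by (simp add: eq)
qed

section \<open>Integration over the sphere\<close>

lemma sgn_measurable_spherical:
  "sgn \<in> measurable (restrict_space lborel (cball 0 1 - {0})) (restrict_space borel (sphere (0::'a::euclidean_space) 1))"
proof (rule measurable_restrict_space2)
  have "sgn \<in> borel_measurable (borel :: 'a measure)"
    unfolding sgn_div_norm by measurable
  then show "sgn \<in> borel_measurable (restrict_space lborel (cball 0 1 - {0::'a}))"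
    by (intro measurable_restrict_space1) simp
qed (auto simp: space_restrict_space norm_sgn)

text \<open>Change of variables for the push-forward under \<open>sgn\<close>: an integral over the
  sphere becomes a volume integral of the extension that is constant on rays, which is the form the
  polar volume formula uses.\<close>

lemma nn_integral_spherical_measure:
  fixes f :: "'a::euclidean_space \<Rightarrow> ennreal"
  assumes "f \<in> borel_measurable (restrict_space borel (sphere 0 1))"
  shows "(\<integral>\<^sup>+u. f u \<partial>spherical_measure) =
    of_nat DIM('a) * (\<integral>\<^sup>+x. f (sgn x) * indicator (cball 0 1 - {0}) x \<partial>lborel)"
proof -
  let ?D = "cball 0 1 - {0::'a}"
  have m: "sgn \<in> measurable (scale_measure (of_nat DIM('a)) (restrict_space lborel ?D)) (restrict_space borel (sphere (0::'a) 1))"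
    using sgn_measurable_spherical by (simp cong: measurable_cong_sets)
  have m': "(\<lambda>x. f (sgn x)) \<in> borel_measurable (restrict_space lborel ?D)"
    using measurable_compose[OF sgn_measurable_spherical assms] .
  show ?thesis
    unfolding spherical_measure_def
    by (simp add: nn_integral_distr[OF m] assms nn_integral_scale_measure[OF m'] nn_integral_restrict_space)
qed

lemma emeasure_lborel_punctured_cball:
  "emeasure lborel (cball 0 1 - {0::'a::euclidean_space}) = emeasure lborel (cball (0::'a) 1)"
  by (subst emeasure_Diff) auto

lemma emeasure_spherical_measure_space:
  "emeasure spherical_measure (sphere (0::'a::euclidean_space) 1) =
     of_nat DIM('a) * emeasure lborel (cball (0::'a) 1)"
proof -
  have "emeasure spherical_measure (sphere (0::'a) 1) = (\<integral>\<^sup>+u. 1 \<partial>(spherical_measure :: 'a measure))"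
    by (simp add: space_spherical_measure)
  also have "\<dots> = of_nat DIM('a) * emeasure lborel (cball (0::'a) 1)"
    by (subst nn_integral_spherical_measure) (simp_all add: emeasure_lborel_punctured_cball)
  finally show ?thesis .
qed

text \<open>A non-empty open set has positive measure. This is what upgrades statements holding
  almost everywhere to statements holding everywhere.\<close>

lemma open_AE_notin_imp_empty:
  fixes U :: "'a::euclidean_space set"
  assumes "open U" "AE x in lborel. x \<notin> U"
  shows "U = {}"
proof (rule ccontr)
  assume "U \<noteq> {}"
  have "U \<in> null_sets lborel"
    using assms by (subst AE_iff_null_sets) auto
  then have "negligible U"
    by (simp add: negligible_iff_null_sets null_sets_completionI)
  then show False
    using open_not_negligible[OF assms(1) \<open>U \<noteq> {}\<close>] by simp
qed

lemma continuous_on_sphere_imp_measurable_spherical: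
  fixes f :: "'a::euclidean_space \<Rightarrow> real"
  assumes "continuous_on (sphere 0 1) f"
  shows "f \<in> borel_measurable spherical_measure"
  using borel_measurable_continuous_on_restrict[OF assms]
  by (simp cong: measurable_cong_sets add: sets_spherical_measure)

lemma finite_measure_spherical_measure:
  "finite_measure (spherical_measure :: 'a::euclidean_space measure)"
  using emeasure_lborel_cball_finite[of "0::'a" 1]
  by (intro finite_measureI)
     (simp add: space_spherical_measure emeasure_spherical_measure_space ennreal_mult_eq_top_iff)

lemma measure_spherical_measure_space:
  "measure spherical_measure (sphere (0::'a::euclidean_space) 1) =
     real DIM('a) * measure lborel (cball (0::'a) 1)"
  by (simp add: measure_def emeasure_spherical_measure_space enn2real_mult)

lemma continuous_on_sphere_imp_integrable_spherical:
  fixes f :: "'a::euclidean_space \<Rightarrow> real"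
  assumes f: "continuous_on (sphere 0 1) f"
  shows "integrable spherical_measure f"
proof -
  interpret finite_measure "spherical_measure :: 'a measure"
    by (rule finite_measure_spherical_measure)
  have "bounded (f ` sphere 0 1)"
    using f by (intro compact_imp_bounded compact_continuous_image) auto
  then obtain B where "\<forall>u\<in>sphere 0 1. norm (f u) \<le> B"
    by (auto simp: bounded_iff)
  then show ?thesis
    by (intro integrable_const_bound[where B = B] continuous_on_sphere_imp_measurable_spherical f AE_I2)
       (auto simp: space_spherical_measure)
qed

text \<open>The points whose direction has a positive value of \<open>f\<close> form a null set
  because the integral vanishes, and an open set by continuity, so there are none.\<close>

lemma continuous_on_sphere_integral_eq_0:
  fixes f :: "'a::euclidean_space \<Rightarrow> real"
  assumes f: "continuous_on (sphere 0 1) f"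
    and nonneg: "\<And>u. norm u = 1 \<Longrightarrow> 0 \<le> f u"
    and zero: "(LINT u|spherical_measure. f u) = 0" and u: "norm u = 1"
  shows "f u = 0"
proof -
  let ?D = "cball 0 1 - {0::'a}"
  \<comment> \<open>The open ball without the origin is taken because it is open and
    \<open>sgn\<close> is continuous on it.\<close>
  let ?U = "{x \<in> ball 0 1 - {0::'a}. 0 < f (sgn x)}"
  have meas: "(\<lambda>u. ennreal (f u)) \<in> borel_measurable (restrict_space borel (sphere 0 1))"
    using borel_measurable_continuous_on_restrict[OF f] by measurable
  have "AE u in spherical_measure. 0 \<le> f u"
    using nonneg by (intro AE_I2) (simp add: space_spherical_measure)
  then have "(\<integral>\<^sup>+u. ennreal (f u) \<partial>spherical_measure) = 0"
    using nn_integral_eq_integral[OF continuous_on_sphere_imp_integrable_spherical[OF f]] zero by simp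
  then have *: "(\<integral>\<^sup>+x. ennreal (f (sgn x)) * indicator ?D x \<partial>lborel) = 0"
    by (simp add: nn_integral_spherical_measure[OF meas])
  have "(\<lambda>x. ennreal (f (sgn x))) \<in> borel_measurable (restrict_space lborel ?D)"
    using measurable_compose[OF sgn_measurable_spherical meas] .
  then have "(\<lambda>x. ennreal (f (sgn x)) * indicator ?D x) \<in> borel_measurable lborel"
    by (subst (asm) borel_measurable_restrict_space_iff_ennreal) auto
  then have "AE x in lborel. ennreal (f (sgn x)) * indicator ?D x = 0"
    using * by (simp add: nn_integral_0_iff_AE)
  then have "AE x in lborel. x \<notin> ?U"
    by eventually_elim (auto simp: indicator_def split: if_splits)
  moreover have "open ?U"
  proof -
    have "continuous_on (ball 0 1 - {0}) (\<lambda>x. f (sgn x))"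
      by (rule continuous_on_compose2[OF f]) (auto intro!: continuous_intros simp: norm_sgn split: if_splits)
    then have "open ((ball 0 1 - {0}) \<inter> (\<lambda>x. f (sgn x)) -` {0<..})"
      by (intro continuous_open_preimage) auto
    moreover have "(ball 0 1 - {0}) \<inter> (\<lambda>x. f (sgn x)) -` {0<..} = ?U" by auto
    ultimately show ?thesis by simp
  qed
  ultimately have "?U = {}"
    by (intro open_AE_notin_imp_empty)
  \<comment> \<open>The point \<open>u\<close> itself lies on the boundary; halving it gives a point
    of the open ball with the same direction.\<close>
  moreover have "(1/2) *\<^sub>R u \<in> ball 0 1 - {0}" "sgn ((1/2) *\<^sub>R u) = u"
    using u by (auto simp: sgn_div_norm)
  ultimately show ?thesis
    using nonneg[OF u] by (smt (verit) empty_iff mem_Collect_eq)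
qed

section \<open>Star bodies, radial functions and volume\<close>

text \<open>The scales \<open>l\<close> with \<open>l *\<^sub>R u \<in> K\<close> form a non-empty
  compact set, so the maximum defining \<open>radial\<close> is attained; the segment condition
  fills in all smaller nonnegative scales.\<close>

lemma star_body_scaleR_mem_iff:
  assumes K: "star_body K" and u: "norm u = 1" and "0 \<le> l"
  shows "l *\<^sub>R u \<in> K \<longleftrightarrow> l \<le> radial K u"
proof -
  have segment: "closed_segment 0 x \<subseteq> K" if "x \<in> K" for x
    using K that by (auto simp: star_body_def)
  let ?S = "{l. l *\<^sub>R u \<in> K}"
  have "compact K" "K \<noteq> {}"
    using K by (auto simp: star_body_def)
  then have "0 \<in> ?S"
    using segment by auto
  obtain B where B: "\<And>x. x \<in> K \<Longrightarrow> norm x \<le> B"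
    using compact_imp_bounded[OF \<open>compact K\<close>] by (auto simp: bounded_iff)
  have "bounded ?S"
    unfolding bounded_iff using B u by (intro exI[of _ B]) force
  moreover have "closed ((\<lambda>l. l *\<^sub>R u) -` K)"
    using \<open>compact K\<close> by (intro closed_vimage compact_imp_closed continuous_intros)
  ultimately have "compact ?S"
    by (auto simp: compact_eq_bounded_closed vimage_def)
  then obtain L where L: "L \<in> ?S" "\<And>l. l \<in> ?S \<Longrightarrow> l \<le> L"
    using compact_attains_sup[of ?S] \<open>0 \<in> ?S\<close> by blast
  then have radial: "radial K u = L"
    unfolding radial_def by (intro Greatest_equality) auto
  have "0 < L"
    using K u radial by (auto simp: star_body_def)
  have "l *\<^sub>R u \<in> K" if "l \<le> L"
  proof -
    \<comment> \<open>The point sits at parameter \<open>l / L\<close> on the segment from the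
      origin to the extreme point \<open>L *\<^sub>R u\<close>.\<close>
    have "l *\<^sub>R u = (l / L) *\<^sub>R (L *\<^sub>R u)" "0 \<le> l / L" "l / L \<le> 1"
      using \<open>0 < L\<close> \<open>0 \<le> l\<close> that by auto
    then have "l *\<^sub>R u \<in> closed_segment 0 (L *\<^sub>R u)"
      unfolding closed_segment_def by (smt (verit) add_0 mem_Collect_eq scaleR_zero_right)
    then show ?thesis
      using segment L(1) by auto
  qed
  then show ?thesis
    using L(2) radial by auto
qed

text \<open>At the origin \<open>sgn\<close> gives no direction, so the value 1 is put there: it
  admits the origin and keeps the function positive, as \<open>emeasure_radial_graph\<close>
  demands.\<close>

lemma star_body_eq_radial_graph:
  assumes "star_body K"
  shows "K = {x. norm x \<le> (if x = 0 then 1 else radial K (sgn x))}"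
proof (intro set_eqI)
  fix x
  show "x \<in> K \<longleftrightarrow> x \<in> {x. norm x \<le> (if x = 0 then 1 else radial K (sgn x))}"
  proof (cases "x = 0")
    case True
    obtain y where "y \<in> K" "closed_segment 0 y \<subseteq> K"
      using assms by (auto simp: star_body_def)
    then show ?thesis using True by auto
  next
    case False
    then have "x = norm x *\<^sub>R sgn x" by (simp add: sgn_div_norm)
    then show ?thesis
      using star_body_scaleR_mem_iff[OF assms, of "sgn x" "norm x"] False by (auto simp: norm_sgn)
  qed
qed

lemma star_body_radial_bounds:
  fixes K :: "'a::euclidean_space set"
  assumes K: "star_body K"
  obtains m M where "0 < m" "\<And>u. norm u = 1 \<Longrightarrow> m \<le> radial K u" "\<And>u. norm u = 1 \<Longrightarrow> radial K u \<le> M"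
proof -
  have c: "compact (radial K ` sphere 0 1)" and ne: "radial K ` sphere 0 1 \<noteq> {}"
    using K by (auto simp: star_body_def intro!: compact_continuous_image)
  show ?thesis
    using compact_attains_inf[OF c ne] compact_attains_sup[OF c ne] K
    by (auto simp: star_body_def intro!: that)
qed

text \<open>\<open>K\<close> is the region under the ray-constant extension of its radial function,
  so the polar volume formula applies and the resulting volume integral turns back into a spherical
  one.\<close>

lemma star_body_volume_nn_integral:
  fixes K :: "'a::euclidean_space set"
  assumes K: "star_body K"
  shows "(\<integral>\<^sup>+u. ennreal (radial K u ^ DIM('a)) \<partial>spherical_measure) =
    of_nat DIM('a) * emeasure lborel K"
proof -
  let ?g = "\<lambda>x. if x = 0 then 1 else radial K (sgn x)"
  have cont: "continuous_on (sphere 0 1) (radial K)"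
    using K by (simp add: star_body_def)
  obtain m M where mM: "0 < m" "\<And>u. norm u = 1 \<Longrightarrow> m \<le> radial K u" "\<And>u. norm u = 1 \<Longrightarrow> radial K u \<le> M"
    using star_body_radial_bounds[OF K] by metis
  have "continuous_on (- {0}) (\<lambda>x. radial K (sgn x))"
    by (rule continuous_on_compose2[OF cont]) (auto intro!: continuous_intros simp: norm_sgn split: if_splits)
  then have g: "?g \<in> borel_measurable borel"
    using borel_measurable_continuous_on_if[of "{0}" "\<lambda>_. 1" "\<lambda>x. radial K (sgn x)"] by simp
  have "emeasure lborel {x. norm x \<le> ?g x} =
      (\<integral>\<^sup>+x. ennreal (?g x ^ DIM('a)) * indicator (cball 0 1) x \<partial>lborel)"
  \<comment> \<open>The bound has to cover the value 1 at the origin as well as the radial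
    function.\<close>
  proof (rule emeasure_radial_graph[OF g, where M = "max 1 M"])
    show "?g (t *\<^sub>R x) = ?g x" if "0 < t" for t x
      using that by (simp add: sgn_scaleR)
    show "0 < ?g x" for x
      using mM(1) mM(2)[of "sgn x"] by (auto simp: norm_sgn)
    show "?g x \<le> max 1 M" for x
      using mM(3)[of "sgn x"] by (auto simp: norm_sgn)
  qed
  \<comment> \<open>The origin is a null set, so the value assigned there drops out.\<close>
  also have "\<dots> = (\<integral>\<^sup>+x. ennreal (radial K (sgn x) ^ DIM('a)) * indicator (cball 0 1 - {0}) x \<partial>lborel)"
    by (intro nn_integral_cong_AE, use AE_lborel_singleton[of 0] in eventually_elim)
       (auto simp: indicator_def)
  finally show ?thesis
    using borel_measurable_continuous_on_restrict[OF cont] star_body_eq_radial_graph[OF K]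
    by (subst nn_integral_spherical_measure) auto
qed

lemma star_body_volume:
  fixes K :: "'a::euclidean_space set"
  assumes K: "star_body K"
  shows "(LINT u|spherical_measure. radial K u ^ DIM('a)) = real DIM('a) * measure lborel K"
proof -
  have cont: "continuous_on (sphere 0 1) (\<lambda>u. radial K u ^ DIM('a))"
    using K by (intro continuous_on_power) (simp add: star_body_def)
  have "AE u in spherical_measure. 0 \<le> radial K u ^ DIM('a)"
  proof (rule AE_I2)
    fix u :: 'a assume "u \<in> space spherical_measure"
    then have "0 < radial K u"
      using K by (simp add: star_body_def space_spherical_measure)
    then show "0 \<le> radial K u ^ DIM('a)" by simp
  qed
  then have "(LINT u|spherical_measure. radial K u ^ DIM('a)) =
      enn2real (\<integral>\<^sup>+u. ennreal (radial K u ^ DIM('a)) \<partial>spherical_measure)"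
    by (intro integral_eq_nn_integral continuous_on_sphere_imp_measurable_spherical[OF cont])
  then show ?thesis
    by (simp add: star_body_volume_nn_integral[OF K] enn2real_mult measure_def)
qed

lemma star_body_volume_pos:
  fixes K :: "'a::euclidean_space set"
  assumes K: "star_body K"
  shows "0 < measure lborel K"
proof -
  obtain m M where m: "0 < m" "\<And>u. norm u = 1 \<Longrightarrow> m \<le> radial K u" "\<And>u. norm u = 1 \<Longrightarrow> radial K u \<le> M"
    using star_body_radial_bounds[OF K] by metis
  \<comment> \<open>The radius lies below both branches of the function describing \<open>K\<close>
    as a region.\<close>
  have "cball 0 (min 1 m) \<subseteq> K"
  proof
    fix x :: 'a assume x: "x \<in> cball 0 (min 1 m)"
    have "x \<noteq> 0 \<Longrightarrow> m \<le> radial K (sgn x)"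
      by (rule m(2)) (simp add: norm_sgn)
    with x show "x \<in> K"
      by (subst star_body_eq_radial_graph[OF K]) auto
  qed
  moreover have "compact K"
    using K by (simp add: star_body_def)
  ultimately have "measure lborel (cball (0::'a) (min 1 m)) \<le> measure lborel K"
    using emeasure_compact_finite[of K]
    by (intro measure_mono_fmeasurable) (auto simp: fmeasurable_def compact_imp_closed)
  moreover have "0 < measure lborel (cball (0::'a) (min 1 m))"
    using m(1) by (intro content_cball_pos) auto
  ultimately show ?thesis by linarith
qed

lemma radial_scaled_cball:
  fixes u :: "'a::euclidean_space"
  assumes "0 < r" "norm u = 1"
  shows "radial ((\<lambda>x. r *\<^sub>R x) ` cball 0 1) u = r"
proof -
  have ball: "(\<lambda>x. r *\<^sub>R x) ` cball (0::'a) 1 = cball 0 r"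
    using \<open>0 < r\<close> cball_scale[of r 0 1] by simp
  show ?thesis
    unfolding radial_def ball using assms by (intro Greatest_equality) auto
qed

section \<open>Supporting lines and Jensen's inequality\<close>

text \<open>The slope is the infimum of the difference quotients to the right of \<open>m\<close>,
  an interior point because the half-line is open.\<close>

lemma convex_on_supporting_line:
  fixes G :: "real \<Rightarrow> real"
  assumes "convex_on {0<..} G" "0 < m"
  obtains a where "\<And>t. 0 < t \<Longrightarrow> G m + a * (t - m) \<le> G t"
  using convex_le_Inf_differential[OF assms(1), of m] assms(2) by (auto simp: interior_open)

text \<open>The case \<open>x = y\<close>, which the strict inequality excludes, holds with
  equality.\<close>

lemma strictly_convex_on_imp_convex_on:
  assumes "strictly_convex_on S f"
  shows "convex_on S f"
proof (rule convex_onI)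
  show "convex S"
    using assms by (simp add: strictly_convex_on_def)
  fix t :: real and x y assume "0 < t" "t < 1" "x \<in> S" "y \<in> S"
  then show "f ((1 - t) *\<^sub>R x + t *\<^sub>R y) \<le> (1 - t) * f x + t * f y"
  proof (cases "x = y")
    case False
    have "0 < 1 - t" using \<open>t < 1\<close> by simp
    then show ?thesis
      using assms False \<open>0 < t\<close> \<open>x \<in> S\<close> \<open>y \<in> S\<close>
      by (auto simp: strictly_convex_on_def intro: less_imp_le)
  qed (simp add: algebra_simps flip: scaleR_left_distrib)
qed

text \<open>If the graph met the line at a second point \<open>t\<close>, strict convexity would
  push it below the line at the midpoint of \<open>t\<close> and \<open>m\<close>.\<close>

lemma strictly_convex_on_supporting_line_eq:
  fixes G :: "real \<Rightarrow> real"
  assumes G: "strictly_convex_on {0<..} G"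
    and line: "\<And>t. 0 < t \<Longrightarrow> G m + a * (t - m) \<le> G t"
    and "0 < m" "0 < t" and eq: "G t = G m + a * (t - m)"
  shows "t = m"
proof (rule ccontr)
  assume "t \<noteq> m"
  then have "G ((1/2) *\<^sub>R t + (1/2) *\<^sub>R m) < (1/2) * G t + (1/2) * G m"
    using G \<open>0 < m\<close> \<open>0 < t\<close> unfolding strictly_convex_on_def
    by (metis (no_types, lifting) field_sum_of_halves greaterThan_iff half_gt_zero_iff zero_less_one)
  moreover have "G m + a * (((1/2) *\<^sub>R t + (1/2) *\<^sub>R m) - m) \<le> G ((1/2) *\<^sub>R t + (1/2) *\<^sub>R m)"
    using \<open>0 < m\<close> \<open>0 < t\<close> by (intro line) simp
  ultimately show False
    using eq by (simp add: algebra_simps)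
qed

text \<open>
  \<open>D\<close> is the gap between \<open>G\<close> and its supporting line at the mean \<open>m = \<omega> / V\<close>; the linear part
  contributes nothing to its integral.
\<close>
lemma dual_jensen:
  fixes K :: "'a::euclidean_space set" and G :: "real \<Rightarrow> real"
  defines "\<omega> \<equiv> measure lborel (cball (0::'a) 1)" and "V \<equiv> measure lborel K"
    and "I \<equiv> (LINT u|spherical_measure. G ((1 / radial K u) ^ DIM('a)) * radial K u ^ DIM('a))"
  assumes K: "star_body K" and G: "continuous_on {0<..} G" "convex_on {0<..} G"
  shows "real DIM('a) * V * G (\<omega> / V) \<le> I"
    and "strictly_convex_on {0<..} G \<Longrightarrow> I = real DIM('a) * V * G (\<omega> / V) \<Longrightarrow>
      norm u = 1 \<Longrightarrow> radial K u = root DIM('a) (V / \<omega>)"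
proof -
  let ?\<rho> = "radial K" and ?n = "DIM('a)"
  let ?s = "\<lambda>u. (1 / ?\<rho> u) ^ ?n"
  define m where "m = \<omega> / V"
  have "0 < V" unfolding V_def by (rule star_body_volume_pos[OF K])
  have "0 < \<omega>" unfolding \<omega>_def by (rule content_cball_pos) simp
  have "0 < m" using \<open>0 < V\<close> \<open>0 < \<omega>\<close> by (simp add: m_def)
  have pos: "0 < ?\<rho> u" if "norm u = 1" for u
    using K that by (auto simp: star_body_def)
  have cont: "continuous_on (sphere 0 1) ?\<rho>"
    using K by (simp add: star_body_def)
  have cont_s: "continuous_on (sphere 0 1) ?s"
    by (intro continuous_intros cont) (use pos in force)
  have cont_G: "continuous_on (sphere 0 1) (\<lambda>u. G (?s u))"
    by (rule continuous_on_compose2[OF G(1) cont_s]) (use pos in auto)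
  obtain a where line: "\<And>t. 0 < t \<Longrightarrow> G m + a * (t - m) \<le> G t"
    using convex_on_supporting_line[OF G(2) \<open>0 < m\<close>] by blast
  define D where "D u = (G (?s u) - (G m + a * (?s u - m))) * ?\<rho> u ^ ?n" for u
  have cont_D: "continuous_on (sphere 0 1) D"
    unfolding D_def by (intro continuous_intros cont cont_s cont_G)
  have D_nonneg: "0 \<le> D u" if "norm u = 1" for u
    unfolding D_def using pos[OF that] line[of "?s u"] by (intro mult_nonneg_nonneg) auto
  have int: "(LINT u|spherical_measure. D u) = I - real ?n * V * G m"
  proof -
    \<comment> \<open>On the sphere \<open>?s u * ?\<rho> u ^ ?n = 1\<close>, so the term
      \<open>a * ?s u\<close> of the line contributes just the constant \<open>a\<close> after
      weighting.\<close>
    have "(LINT u|spherical_measure. D u) =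
        (LINT u|spherical_measure. G (?s u) * ?\<rho> u ^ ?n - ((G m - a * m) * ?\<rho> u ^ ?n + a))"
      using pos by (intro Bochner_Integration.integral_cong refl)
        (force simp: D_def space_spherical_measure field_simps power_divide)
    also have "\<dots> = I - ((G m - a * m) * (LINT u|spherical_measure. ?\<rho> u ^ ?n) +
        (LINT u|(spherical_measure :: 'a measure). a))"
      unfolding I_def
      by (subst Bochner_Integration.integral_diff Bochner_Integration.integral_add,
          (intro continuous_on_sphere_imp_integrable_spherical continuous_intros cont cont_G)+)+ simp
    \<comment> \<open>The weight has mass \<open>n V\<close> and the sphere has mass
      \<open>n \<omega>\<close>; since \<open>m * V = \<omega>\<close>, the terms with
      \<open>a\<close> cancel.\<close>
    also have "\<dots> = I - real ?n * V * G m"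
      using \<open>0 < V\<close>
      by (simp add: star_body_volume[OF K] space_spherical_measure measure_spherical_measure_space
           m_def flip: \<omega>_def V_def) (simp add: field_simps)
    finally show ?thesis .
  qed
  have "0 \<le> (LINT u|spherical_measure. D u)"
    using D_nonneg by (intro integral_nonneg_AE AE_I2) (auto simp: space_spherical_measure)
  then show "real ?n * V * G (\<omega> / V) \<le> I"
    by (simp add: int m_def)
  assume strict: "strictly_convex_on {0<..} G" and eq: "I = real ?n * V * G (\<omega> / V)" and u: "norm u = 1"
  have "(LINT u|spherical_measure. D u) = 0"
    by (simp add: int eq m_def)
  \<comment> \<open>Continuity makes the gap vanish at every point of the sphere, so
    \<open>G\<close> touches its supporting line at \<open>?s u\<close>.\<close>
  with cont_D D_nonneg have "D u = 0"
    using u by (rule continuous_on_sphere_integral_eq_0)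
  then have "G (?s u) = G m + a * (?s u - m)"
    using pos[OF u] by (simp add: D_def)
  then have "?s u = m"
    using strict line \<open>0 < m\<close> pos[OF u] by (intro strictly_convex_on_supporting_line_eq[of G m a]) auto
  then have "?\<rho> u ^ ?n = V / \<omega>"
    using \<open>0 < V\<close> \<open>0 < \<omega>\<close> pos[OF u] by (simp add: m_def field_simps power_divide)
  then show "?\<rho> u = root ?n (V / \<omega>)"
    using pos[OF u] by (metis DIM_positive less_imp_le real_root_power_cancel)
qed

section \<open>Dual surface areas of a star body and of its volume ball\<close>

lemma orlicz_dual_surface_area_eq:
  fixes K :: "'a::euclidean_space set"
  shows "orlicz_dual_surface_area \<phi> K =
    (LINT u|spherical_measure. \<phi> (1 / radial K u) * radial K u ^ DIM('a))"
proof -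
  have "radial (cball 0 1) u = 1" if "norm u = 1" for u :: 'a
    using radial_scaled_cball[of 1 u] that by simp
  then have "(LINT u|spherical_measure. \<phi> (radial (cball 0 1) u / radial K u) * radial K u ^ DIM('a)) =
      (LINT u|spherical_measure. \<phi> (1 / radial K u) * radial K u ^ DIM('a))"
    by (intro Bochner_Integration.integral_cong) (simp_all add: space_spherical_measure)
  then show ?thesis
    by (simp add: orlicz_dual_surface_area_def orlicz_dual_mixed_volume_def)
qed

text \<open>Inserting the root of a power exhibits the integrand as \<open>F\<close> of the inverse
  \<open>n\<close>-th power of the radial function, the shape of \<open>I\<close> in
  \<open>dual_jensen\<close>.\<close>

lemma orlicz_dual_surface_area_root:
  fixes K :: "'a::euclidean_space set"
  assumes "star_body K"
  shows "orlicz_dual_surface_area \<phi> K =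
    (LINT u|spherical_measure. \<phi> (root DIM('a) ((1 / radial K u) ^ DIM('a))) * radial K u ^ DIM('a))"
  unfolding orlicz_dual_surface_area_eq using assms
  by (intro Bochner_Integration.integral_cong refl)
     (simp add: real_root_power_cancel star_body_def space_spherical_measure less_imp_le)

lemma vrad_pos:
  assumes "star_body K"
  shows "0 < vrad K"
  unfolding vrad_def
  using star_body_volume_pos[OF assms] content_cball_pos[of 1] by (intro real_root_gt_zero) simp_all

text \<open>The radial function is the constant \<open>vrad K\<close>, whose \<open>n\<close>-th
  power is the volume ratio, so only the mass of the sphere is integrated. The result is exactly the
  Jensen bound.\<close>

lemma orlicz_dual_surface_area_vrad_ball:
  fixes K :: "'a::euclidean_space set"
  assumes K: "star_body K"
  shows "orlicz_dual_surface_area \<phi> (vrad_ball K) =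
    real DIM('a) * measure lborel K *
      \<phi> (root DIM('a) (measure lborel (cball (0::'a) 1) / measure lborel K))"
proof -
  let ?r = "vrad K" and ?V = "measure lborel K" and ?\<omega> = "measure lborel (cball (0::'a) 1)"
  have "0 < ?V" "0 < ?\<omega>"
    using star_body_volume_pos[OF K] content_cball_pos[of 1] by auto
  then have pow: "?r ^ DIM('a) = ?V / ?\<omega>"
    unfolding vrad_def by (intro real_root_pow_pos2) auto
  have inv: "1 / ?r = root DIM('a) (?\<omega> / ?V)"
    by (simp add: vrad_def real_root_divide)
  have "radial (vrad_ball K) u = ?r" if "norm u = 1" for u
    unfolding vrad_ball_def using vrad_pos[OF K] that by (rule radial_scaled_cball)
  then have "orlicz_dual_surface_area \<phi> (vrad_ball K) =
      (LINT u|(spherical_measure :: 'a measure). \<phi> (1 / ?r) * ?r ^ DIM('a))"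
    unfolding orlicz_dual_surface_area_eq
    by (intro Bochner_Integration.integral_cong) (simp_all add: space_spherical_measure)
  also have "\<dots> = real DIM('a) * ?\<omega> * (\<phi> (1 / ?r) * (?V / ?\<omega>))"
    by (simp only: lebesgue_integral_const space_spherical_measure measure_spherical_measure_space pow) simp
  also have "\<dots> = real DIM('a) * ?V * \<phi> (1 / ?r)"
    using \<open>0 < ?\<omega>\<close> by simp
  finally show ?thesis
    by (simp only: inv)
qed

text \<open>This is the easy half of the equality case: a centred ball is its own volume ball, so
  the two areas coincide.\<close>

lemma vrad_ball_scaled_cball:
  fixes K :: "'a::euclidean_space set"
  assumes "0 < r" and K: "K = (\<lambda>x. r *\<^sub>R x) ` cball 0 1"
  shows "vrad_ball K = K"
proof -
  have pos: "0 < measure lborel (cball (0::'a) 1)"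
    by (rule content_cball_pos) simp
  have "K = cball 0 r"
    using assms cball_scale[of r "0::'a" 1] by simp
  \<comment> \<open>The whole space is a cone, so the scaling law for cones gives the volume of a
    ball.\<close>
  then have "emeasure lborel K = ennreal (r ^ DIM('a)) * emeasure lborel (cball (0::'a) 1)"
    using emeasure_cone_Int_cball[of "UNIV :: 'a set" r] \<open>0 < r\<close> by simp
  then have "measure lborel K = r ^ DIM('a) * measure lborel (cball (0::'a) 1)"
    using \<open>0 < r\<close> by (simp add: measure_def enn2real_mult)
  then have "vrad K = r"
    using pos \<open>0 < r\<close> by (simp add: vrad_def real_root_power_cancel)
  then show ?thesis
    by (simp add: vrad_ball_def K)
qed

lemma origin_symmetric_ball_if_radial_const:
  fixes K :: "'a::euclidean_space set"
  assumes K: "star_body K" and "0 < r" and radial: "\<And>u. norm u = 1 \<Longrightarrow> radial K u = r"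
  shows "origin_symmetric_ball K"
proof -
  have "K = {x. norm x \<le> (if x = 0 then 1 else radial K (sgn x))}"
    by (rule star_body_eq_radial_graph[OF K])
  also have "\<dots> = cball 0 r"
    using \<open>0 < r\<close> radial by (auto simp: norm_sgn)
  also have "\<dots> = (\<lambda>x. r *\<^sub>R x) ` cball 0 1"
    using \<open>0 < r\<close> cball_scale[of r "0::'a" 1] by simp
  finally show ?thesis
    using \<open>0 < r\<close> unfolding origin_symmetric_ball_def by blast
qed

section \<open>The isoperimetric inequality and its equality case\<close>

text \<open>Both claims are \<open>dual_jensen\<close> for \<open>G = F\<close>, once the two areas
  are rewritten as the integral and as the Jensen bound.\<close>

lemma dual_orlicz_isoperimetric_convex:
  fixes K :: "'a::euclidean_space set" and \<phi> :: "real \<Rightarrow> real"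
  assumes K: "star_body K" and \<phi>: "continuous_on {0<..} \<phi>"
    and convex: "convex_on {0<..} (\<lambda>t. \<phi> (root DIM('a) t))"
  shows "orlicz_dual_surface_area \<phi> (vrad_ball K) \<le> orlicz_dual_surface_area \<phi> K"
    and "strictly_convex_on {0<..} (\<lambda>t. \<phi> (root DIM('a) t)) \<Longrightarrow>
      orlicz_dual_surface_area \<phi> K = orlicz_dual_surface_area \<phi> (vrad_ball K) \<Longrightarrow>
      origin_symmetric_ball K"
proof -
  have cont: "continuous_on {0<..} (\<lambda>t. \<phi> (root DIM('a) t))"
    by (rule continuous_on_compose2[OF \<phi>]) (auto intro!: continuous_intros)
  note jensen = dual_jensen[OF K cont convex]
  show "orlicz_dual_surface_area \<phi> (vrad_ball K) \<le> orlicz_dual_surface_area \<phi> K"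
    using jensen(1) by (simp only: orlicz_dual_surface_area_vrad_ball[OF K] orlicz_dual_surface_area_root[OF K])
  assume strict: "strictly_convex_on {0<..} (\<lambda>t. \<phi> (root DIM('a) t))"
    and "orlicz_dual_surface_area \<phi> K = orlicz_dual_surface_area \<phi> (vrad_ball K)"
  \<comment> \<open>The constant that the equality case of Jensen's inequality yields is the
    definition of \<open>vrad K\<close>.\<close>
  then have "radial K u = vrad K" if "norm u = 1" for u
    using jensen(2)[OF strict _ that]
    by (simp only: orlicz_dual_surface_area_vrad_ball[OF K] orlicz_dual_surface_area_root[OF K] vrad_def)
  then show "origin_symmetric_ball K"
    by (rule origin_symmetric_ball_if_radial_const[OF K vrad_pos[OF K]])
qed

lemma orlicz_dual_surface_area_uminus:
  "orlicz_dual_surface_area (\<lambda>t. - \<phi> t) K = - orlicz_dual_surface_area \<phi> K"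
  by (simp add: orlicz_dual_surface_area_eq)

theorem theorem3p5:
  fixes K :: "'a::euclidean_space set" and \<phi> :: "real \<Rightarrow> real"
  assumes "star_body K"
    and "continuous_on {0<..} \<phi>"
    and "\<And>t. 0 < t \<Longrightarrow> 0 < \<phi> t"
  shows "let F = (\<lambda>t. \<phi> (root DIM('a) t)) in
     (concave_on {0<..} F \<longrightarrow>
        orlicz_dual_surface_area \<phi> K \<le> orlicz_dual_surface_area \<phi> (vrad_ball K)) \<and>
     (convex_on {0<..} F \<longrightarrow>
        orlicz_dual_surface_area \<phi> K \<ge> orlicz_dual_surface_area \<phi> (vrad_ball K)) \<and>
     (strictly_concave_on {0<..} F \<or> strictly_convex_on {0<..} F \<longrightarrow>
        (orlicz_dual_surface_area \<phi> K = orlicz_dual_surface_area \<phi> (vrad_ball K)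
           \<longleftrightarrow> origin_symmetric_ball K))"
proof -
  let ?F = "\<lambda>t. \<phi> (root DIM('a) t)" and ?S = orlicz_dual_surface_area
  note convex = dual_orlicz_isoperimetric_convex[OF assms(1,2)]
  \<comment> \<open>Concavity of \<open>F\<close> is convexity of \<open>- F\<close>, so the concave
    case is the convex one for \<open>- \<phi>\<close>, where both areas change sign and the
    inequality turns round.\<close>
  have "continuous_on {0<..} (\<lambda>t. - \<phi> t)"
    by (intro continuous_intros assms(2))
  note concave = dual_orlicz_isoperimetric_convex[OF assms(1) this, unfolded orlicz_dual_surface_area_uminus]
  have "?S \<phi> K \<le> ?S \<phi> (vrad_ball K)" if "concave_on {0<..} ?F"
    using concave(1) that by (simp add: concave_on_def)
  moreover have "?S \<phi> (vrad_ball K) \<le> ?S \<phi> K" if "convex_on {0<..} ?F"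
    using convex(1) that .
  moreover have "origin_symmetric_ball K"
    if "strictly_concave_on {0<..} ?F \<or> strictly_convex_on {0<..} ?F" "?S \<phi> K = ?S \<phi> (vrad_ball K)"
    using that concave(2) convex(2) strictly_convex_on_imp_convex_on
    unfolding strictly_concave_on_def by metis
  moreover have "?S \<phi> K = ?S \<phi> (vrad_ball K)" if "origin_symmetric_ball K"
    using that vrad_ball_scaled_cball unfolding origin_symmetric_ball_def by metis
  ultimately show ?thesis
    unfolding Let_def by blast
qed

end
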